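(* Let $D$ be an $n\times n$ unit spherical EDM of embedding dimension $r$, let $w=D^\dagger e$, and let $1\le k<l\le n$. Let $(\tilde z^i)^T$ denote the $i$th row of $\tilde Z$, where $\tilde Z=w$ if $r=n-1$ and $\tilde Z=[\,w\;\;Z\,]$ if $r\le n-2$, and assume that $\tilde z^k=c\,\tilde z^l$ for some nonzero scalar $c$. Let $\rho_{kl}(t)$ denote the radius of $D+tE^{kl}$ for $t\in T^{\leq}_{kl}$. If either (i) $w_k=w_l=0$, or (ii) $w_k\neq 0$, $r\le n-2$ and $z^k\neq 0$, then $\rho_{kl}(t)=1$ for all $t\in T^{\leq}_{kl}$, and thus $T^{=}_{kl}=T^{\leq}_{kl}$.
   Context: An $n\times n$ real matrix $D=(d_{ij})$ is a Euclidean distance matrix (EDM) if there are points $p^1,\dots,p^n$ (generating points) in some Euclidean space with $d_{ij}=\|p^i-p^j\|^2$ for all $i,j$; the dimension of their affine span is the embedding dimension $r$ of $D$. $D$ is spherical of radius $\rho$ if its generating points, taken in $\mathbb{R}^r$, lie on a sphere of radius $\rho$ in $\mathbb{R}^r$ (equivalently, there is a scalar $\beta$ with $\beta ee^T-D\succeq 0$, and the smallest such $\beta$ is $2\rho^2$; $D=0$ counts as spherical of radius $0$). A unit spherical EDM is a spherical EDM of radius $1$. $e$ is the all-ones vector in $\mathbb{R}^n$, $M^\dagger$ is the Moore-Penrose inverse, and $w=D^\dagger e$ satisfies $Dw=e$. If $r\le n-2$, a Gale matrix $Z$ of $D$ is an $n\times(n-r-1)$ matrix whose columns form a basis of $\{x\in\mathbb{R}^n: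 P^Tx=0,\ e^Tx=0\}$, where $P$ is the $n\times r$ matrix whose rows are generating points of $D$ in $\mathbb{R}^r$; $(z^i)^T$ denotes the $i$th row of $Z$. $E^{kl}$ is the $n\times n$ symmetric matrix with $1$'s in positions $kl$ and $lk$ and zeros elsewhere. $T^{\leq}_{kl}$ is the set of real $t$ such that $D+tE^{kl}$ is a spherical EDM of radius $\rho\le 1$, and $T^{=}_{kl}$ is the set of $t\in T^{\leq}_{kl}$ such that $D+tE^{kl}$ is a unit spherical EDM. *)

theory Defs
  imports Complex_Main "Jordan_Normal_Form.VS_Connect"
begin

text \<open>An \<open>n\<close>-point configuration in \<open>\<real>\<^sup>d\<close> is an \<open>n \<times> d\<close> matrix whose rows are the points.
  All indices start at 0.\<close>

definition sq_dist :: "real vec \<Rightarrow> real vec \<Rightarrow> real" where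
  "sq_dist u v = (u - v) \<bullet> (u - v)"

definition ones_vec :: "nat \<Rightarrow> real vec" where
  "ones_vec n = vec n (\<lambda>_. 1)"

definition generates_edm :: "nat \<Rightarrow> real mat \<Rightarrow> real mat \<Rightarrow> bool" where
  "generates_edm d P D \<longleftrightarrow>
     D \<in> carrier_mat (dim_row D) (dim_row D) \<and> P \<in> carrier_mat (dim_row D) d \<and>
     (\<forall>i < dim_row D. \<forall>j < dim_row D. D $$ (i, j) = sq_dist (row P i) (row P j))"

definition affine_span :: "real mat \<Rightarrow> real vec set" where
  "affine_span P = {P\<^sup>T *\<^sub>v x | x. x \<in> carrier_vec (dim_row P) \<and> ones_vec (dim_row P) \<bullet> x = 1}"

text \<open>The dimension of a (nonempty) affine subspace is that of its direction space.\<close>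

definition affine_span_dim :: "real mat \<Rightarrow> nat" where
  "affine_span_dim P = vectorspace.dim class_ring
     (module_vec TYPE(real) (dim_col P)
        \<lparr>carrier := {u - v | u v. u \<in> affine_span P \<and> v \<in> affine_span P}\<rparr>)"

definition embedding_dim :: "real mat \<Rightarrow> nat \<Rightarrow> bool" where
  "embedding_dim D r \<longleftrightarrow> (\<exists>d P. generates_edm d P D \<and> affine_span_dim P = r)"

text \<open>The sphere lives in \<open>\<real>\<^sup>r\<close> for \<open>r\<close> the embedding dimension, that is, in a space
  affinely spanned by the generating points.  In a larger space the radius would not be
  determined by the matrix.\<close>

definition spherical_edm :: "real mat \<Rightarrow> real \<Rightarrow> bool" where
  "spherical_edm D \<rho> \<longleftrightarrow> \<rho> \<ge> 0 \<and>
     (\<exists>r P. generates_edm r P D \<and> affine_span_dim P = r \<and>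
        (\<exists>a \<in> carrier_vec r. \<forall>i < dim_row D. sq_dist (row P i) a = \<rho>\<^sup>2))"

definition edm_radius :: "real mat \<Rightarrow> real" where
  "edm_radius D = (THE \<rho>. spherical_edm D \<rho>)"

text \<open>The four Penrose conditions.\<close>

definition moore_penrose :: "real mat \<Rightarrow> real mat \<Rightarrow> bool" where
  "moore_penrose M X \<longleftrightarrow> X \<in> carrier_mat (dim_col M) (dim_row M) \<and>
     M * X * M = M \<and> X * M * X = X \<and> (M * X)\<^sup>T = M * X \<and> (X * M)\<^sup>T = X * M"

definition gale_matrix :: "real mat \<Rightarrow> nat \<Rightarrow> real mat \<Rightarrow> bool" where
  "gale_matrix D r Z \<longleftrightarrow> (let n = dim_row D in
     Z \<in> carrier_mat n (n - r - 1) \<and>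
     (\<exists>P. generates_edm r P D \<and> distinct (cols Z) \<and>
        vectorspace.basis class_ring
          (module_vec TYPE(real) n
             \<lparr>carrier := {x \<in> carrier_vec n. P\<^sup>T *\<^sub>v x = 0\<^sub>v r \<and> ones_vec n \<bullet> x = 0}\<rparr>)
          (set (cols Z))))"

definition extended_gale :: "nat \<Rightarrow> real vec \<Rightarrow> real mat \<Rightarrow> real mat" where
  "extended_gale r w Z =
     (if r = dim_vec w - 1 then mat_of_cols (dim_vec w) [w]
      else mat_of_cols (dim_vec w) (w # cols Z))"

definition sym_unit_mat :: "nat \<Rightarrow> nat \<Rightarrow> nat \<Rightarrow> real mat" where
  "sym_unit_mat n k l =
     mat n n (\<lambda>(i, j). if i = k \<and> j = l \<or> i = l \<and> j = k then 1 else 0)"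

definition perturbed :: "real mat \<Rightarrow> nat \<Rightarrow> nat \<Rightarrow> real \<Rightarrow> real mat" where
  "perturbed D k l t = D + t \<cdot>\<^sub>m sym_unit_mat (dim_row D) k l"

definition T_le :: "real mat \<Rightarrow> nat \<Rightarrow> nat \<Rightarrow> real set" where
  "T_le D k l = {t. \<exists>\<rho> \<le> 1. spherical_edm (perturbed D k l t) \<rho>}"

definition T_eq :: "real mat \<Rightarrow> nat \<Rightarrow> nat \<Rightarrow> real set" where
  "T_eq D k l = {t \<in> T_le D k l. spherical_edm (perturbed D k l t) 1}"

end

theory Submission
  imports Defs
begin

text \<open>The centre of the sphere through the generating points of a spherical EDM \<open>M\<close> of radius
  \<open>\<rho>\<close> is an affine combination \<open>x\<close> of these points, and then \<open>M x = 2 \<rho>\<^sup>2 e\<close> with \<open>e\<^sup>T x = 1\<close>.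
  Hence, \<open>M\<close> being symmetric, any \<open>y\<close> with \<open>M y = e\<close> satisfies \<open>1 = 2 \<rho>\<^sup>2 e\<^sup>T y\<close>.

  For the unit spherical \<open>D\<close> this gives \<open>D w = e\<close> and \<open>e\<^sup>T w = 1/2\<close>. If some \<open>y\<close> satisfies
  \<open>D y = e\<close>, \<open>e\<^sup>T y = 1/2\<close> and \<open>y\<^sub>k = y\<^sub>l = 0\<close>, then the perturbation does not affect \<open>D y = e\<close>,
  so the perturbed matrix has radius 1 whenever it is spherical. In case (i) take \<open>y = w\<close>. In case
  (ii) subtract from \<open>w\<close> the multiple of a Gale column \<open>z\<close> with \<open>z\<^sub>k \<noteq> 0\<close> that cancels the \<open>k\<close>th
  entry; proportionality of the rows makes the \<open>l\<close>th entry vanish as well, and \<open>D z = 0\<close>.\<close>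

section \<open>Linear algebra: subspaces of full dimension\<close>

lemma (in vectorspace) subspace_eq_carrier_if_dim_eq:
  assumes W: "subspace K W V" and fd: "fin_dim" and deq: "vectorspace.dim K (vs W) = dim"
  shows "W = carrier V"
proof -
  interpret W: vectorspace K "vs W" by (rule subspace_is_vs[OF W])
  have sm: "submodule K W V" using W by (simp add: subspace_def)
  have WV: "W \<subseteq> carrier V" using sm by (simp add: submodule_def)
  have li: "lin_indpt A" if "A \<subseteq> W" "W.lin_indpt A" for A
    using span_li_not_depend(2)[OF that(1) sm] that(2) by simp
  \<comment> \<open>Finite-dimensionality of \<open>W\<close> has to be established first: an
    independent subset of \<open>W\<close> is independent in \<open>V\<close>, so its size is
    bounded by \<open>dim\<close> and a maximal one exists. It is a basis of \<open>W\<close>, and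
    having \<open>dim\<close> elements it is also a basis of \<open>V\<close>.\<close>
  have "\<exists>A. finite A \<and> maximal A (\<lambda>S. S \<subseteq> carrier (vs W) \<and> W.lin_indpt S)"
  proof (rule maximal_exists[where N = dim and B = "{}"])
    fix A assume A: "A \<subseteq> carrier (vs W) \<and> W.lin_indpt A"
    then have "A \<subseteq> W" by simp
    then show "finite A \<and> card A \<le> dim"
      using li_le_dim[OF fd, of A] li[of A] A WV by auto
  next
    show "{} \<subseteq> carrier (vs W) \<and> W.lin_indpt {}" by (simp add: W.lin_dep_def)
  qed
  then obtain A where A: "finite A" "maximal A (\<lambda>S. S \<subseteq> carrier (vs W) \<and> W.lin_indpt S)"
    by blast
  have B: "W.basis A" by (rule W.max_li_is_basis[OF A(2)])
  have AW: "A \<subseteq> W" and Wli: "W.lin_indpt A" and Wgen: "W.span A = W"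
    using B by (simp_all add: W.basis_def)
  have "card A = dim" using W.dim_basis[OF A(1) B] deq by simp
  then have "basis A" using AW WV A(1) li[OF AW Wli] by (intro dim_li_is_basis[OF fd]) auto
  then have "span A = carrier V" by (simp add: basis_def)
  moreover have "span A = W" using span_li_not_depend(1)[OF AW sm] Wgen by simp
  ultimately show ?thesis by simp
qed

lemma smult_zero_vec_right: "a \<cdot>\<^sub>v 0\<^sub>v n = (0\<^sub>v n :: 'a::mult_zero vec)"
  by (intro eq_vecI) simp_all

lemma subspace_vec:
  assumes "W \<subseteq> carrier_vec n" and "0\<^sub>v n \<in> W"
    and "\<And>u v. u \<in> W \<Longrightarrow> v \<in> W \<Longrightarrow> u + v \<in> W"
    and "\<And>a u. u \<in> W \<Longrightarrow> a \<cdot>\<^sub>v u \<in> W"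
  shows "VectorSpace.subspace class_ring W (module_vec TYPE('a::field) n)"
proof -
  interpret vec_space "TYPE('a)" n .
  show ?thesis
    unfolding VectorSpace.subspace_def submodule_def
    using assms vec_vs vec_module by (auto simp: module_vec_simps)
qed

section \<open>Affine combinations of the generating points\<close>

lemma ones_vec_carrier [simp]: "ones_vec n \<in> carrier_vec n" "dim_vec (ones_vec n) = n"
  by (auto simp: ones_vec_def)

lemma ones_vec_scalar_prod:
  assumes "x \<in> carrier_vec n"
  shows "ones_vec n \<bullet> x = (\<Sum>j<n. x $ j)"
  using assms by (auto simp: ones_vec_def scalar_prod_def atLeast0LessThan)

lemma ones_vec_index [simp]: "i < n \<Longrightarrow> ones_vec n $ i = 1"
  by (simp add: ones_vec_def)

text \<open>Subtracting two weight vectors of sum 1 leaves one of sum 0; conversely, a weight vector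
  of sum 0 becomes one of sum 1 by adding \<open>unit_vec n 0\<close>, which selects the first
  point. For \<open>n = 0\<close> the left side would be empty.\<close>

lemma direction_space_eq:
  assumes P: "P \<in> carrier_mat n d" and n: "0 < n"
  shows "{u - v | u v. u \<in> affine_span P \<and> v \<in> affine_span P}
    = {P\<^sup>T *\<^sub>v y | y. y \<in> carrier_vec n \<and> ones_vec n \<bullet> y = 0}" (is "?L = ?R")
proof (intro equalityI subsetI)
  fix a assume "a \<in> ?L"
  then obtain x y where xy: "x \<in> carrier_vec n" "y \<in> carrier_vec n"
    "ones_vec n \<bullet> x = 1" "ones_vec n \<bullet> y = 1" and a: "a = P\<^sup>T *\<^sub>v x - P\<^sup>T *\<^sub>v y"
    using P by (auto simp: affine_span_def)
  have "a = P\<^sup>T *\<^sub>v (x - y)"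
    using a mult_minus_distrib_mat_vec[of "P\<^sup>T" d n x y] P xy by simp
  moreover have "ones_vec n \<bullet> (x - y) = 0"
    using scalar_prod_minus_distrib[of "ones_vec n" n x y] xy by simp
  ultimately show "a \<in> ?R" using xy by auto
next
  fix a assume "a \<in> ?R"
  then obtain y where y: "y \<in> carrier_vec n" "ones_vec n \<bullet> y = 0" and a: "a = P\<^sup>T *\<^sub>v y"
    by auto
  let ?u = "unit_vec n 0 :: real vec"
  have u: "?u \<in> carrier_vec n" "ones_vec n \<bullet> ?u = 1"
    using n by (simp_all)
  have uy: "ones_vec n \<bullet> (?u + y) = 1"
    using scalar_prod_add_distrib[of "ones_vec n" n ?u y] u y by simp
  have c: "P\<^sup>T *\<^sub>v ?u \<in> carrier_vec d" "P\<^sup>T *\<^sub>v y \<in> carrier_vec d" using P u(1) y by auto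
  have "a = P\<^sup>T *\<^sub>v (?u + y) - P\<^sup>T *\<^sub>v ?u"
    using mult_add_distrib_mat_vec[of "P\<^sup>T" d n ?u y] P u y a c by auto
  moreover have "P\<^sup>T *\<^sub>v (?u + y) \<in> affine_span P" "P\<^sup>T *\<^sub>v ?u \<in> affine_span P"
    using P u uy y by (auto simp: affine_span_def)
  ultimately show "a \<in> ?L" by blast
qed

text \<open>Full affine dimension makes the direction space all of the ambient space, so
  \<open>a\<close> minus the first point is a combination with weights of sum 0. This is what lets
  the centre of a sphere be written as an affine combination of the points.\<close>

lemma affine_span_full:
  assumes P: "P \<in> carrier_mat n d" and n: "0 < n" and dim: "affine_span_dim P = d"
    and a: "a \<in> carrier_vec d"
  shows "\<exists>x \<in> carrier_vec n. ones_vec n \<bullet> x = 1 \<and> P\<^sup>T *\<^sub>v x = a"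
proof -
  interpret vec_space "TYPE(real)" d .
  define W where "W = {P\<^sup>T *\<^sub>v y | y. y \<in> carrier_vec n \<and> ones_vec n \<bullet> y = 0}"
  have PT: "P\<^sup>T \<in> carrier_mat d n" using P by simp
  have "VectorSpace.subspace class_ring W V"
  proof (rule subspace_vec)
    show "W \<subseteq> carrier_vec d" using PT by (auto simp: W_def)
    show "0\<^sub>v d \<in> W" using PT by (auto simp: W_def intro!: exI[of _ "0\<^sub>v n"])
    show "u + v \<in> W" if uv: "u \<in> W" "v \<in> W" for u v
    proof -
      obtain x y where xy: "x \<in> carrier_vec n" "ones_vec n \<bullet> x = 0" "u = P\<^sup>T *\<^sub>v x"
        "y \<in> carrier_vec n" "ones_vec n \<bullet> y = 0" "v = P\<^sup>T *\<^sub>v y"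
        using uv by (auto simp: W_def)
      then have "u + v = P\<^sup>T *\<^sub>v (x + y)" "ones_vec n \<bullet> (x + y) = 0"
        using mult_add_distrib_mat_vec[OF PT] scalar_prod_add_distrib[of "ones_vec n" n x y]
        by simp_all
      then show ?thesis using xy by (auto simp: W_def)
    qed
    show "b \<cdot>\<^sub>v u \<in> W" if u: "u \<in> W" for b u
    proof -
      obtain x where x: "x \<in> carrier_vec n" "ones_vec n \<bullet> x = 0" "u = P\<^sup>T *\<^sub>v x"
        using u by (auto simp: W_def)
      then have "b \<cdot>\<^sub>v u = P\<^sup>T *\<^sub>v (b \<cdot>\<^sub>v x)" "ones_vec n \<bullet> (b \<cdot>\<^sub>v x) = 0"
        using mult_mat_vec[OF PT] by simp_all
      then show ?thesis using x by (auto simp: W_def)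
    qed
  qed
  moreover have "vectorspace.dim class_ring (vs W) = local.dim"
    using dim P unfolding affine_span_dim_def direction_space_eq[OF P n] W_def[symmetric] dim_is_n
    by simp
  ultimately have W: "W = carrier_vec d"
    using subspace_eq_carrier_if_dim_eq[of W] fin_dim by simp
  let ?u = "unit_vec n 0 :: real vec"
  have u: "?u \<in> carrier_vec n" "ones_vec n \<bullet> ?u = 1" and Pu: "P\<^sup>T *\<^sub>v ?u \<in> carrier_vec d"
    using n PT by (simp_all)
  have "a - P\<^sup>T *\<^sub>v ?u \<in> W" using a Pu W by simp
  then obtain y where y: "y \<in> carrier_vec n" "ones_vec n \<bullet> y = 0" "a - P\<^sup>T *\<^sub>v ?u = P\<^sup>T *\<^sub>v y"
    by (auto simp: W_def)
  have "P\<^sup>T *\<^sub>v (?u + y) = P\<^sup>T *\<^sub>v ?u + (a - P\<^sup>T *\<^sub>v ?u)"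
    using mult_add_distrib_mat_vec[OF PT u(1) y(1)] y(3) by simp
  also have "\<dots> = a"
  proof -
    have "p + (a - p) = a" if "p \<in> carrier_vec d" for p
      using that a by (intro eq_vecI) auto
    then show ?thesis using Pu by blast
  qed
  finally have "P\<^sup>T *\<^sub>v (?u + y) = a" .
  moreover have "ones_vec n \<bullet> (?u + y) = 1"
    using scalar_prod_add_distrib[of "ones_vec n" n ?u y] u y by simp
  ultimately show ?thesis using u y by (intro bexI[of _ "?u + y"]) auto
qed

section \<open>The action of a distance matrix on a vector\<close>

lemma sq_dist_expand:
  assumes "u \<in> carrier_vec d" "v \<in> carrier_vec d"
  shows "sq_dist u v = u \<bullet> u + v \<bullet> v - 2 * (u \<bullet> v)"
  using assms
  by (simp add: sq_dist_def minus_scalar_prod_distrib[of _ d] scalar_prod_minus_distrib[of _ d]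
      comm_scalar_prod[of v d u])

lemma sum_rows_scalar_prod:
  fixes P :: "real mat"
  assumes P: "P \<in> carrier_mat n d" and x: "x \<in> carrier_vec n" and v: "v \<in> carrier_vec d"
  shows "(\<Sum>j<n. (row P j \<bullet> v) * x $ j) = (P\<^sup>T *\<^sub>v x) \<bullet> v"
proof -
  have "(\<Sum>j<n. (row P j \<bullet> v) * x $ j) = (P *\<^sub>v v) \<bullet> x"
    using P x by (auto simp: scalar_prod_def atLeast0LessThan)
  also have "\<dots> = (P\<^sup>T *\<^sub>v x) \<bullet> v"
    using transpose_vec_mult_scalar[OF P v x] P x v
    by (simp add: comm_scalar_prod[of "P *\<^sub>v v" n x])
  finally show ?thesis .
qed

text \<open>Expanding the squared distances isolates the dependence on \<open>i\<close>: only the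
  first and last terms vary with it. They vanish on Gale columns, and for the weights of a sphere's
  centre their variation cancels.\<close>

lemma edm_mult_vec:
  assumes D: "D \<in> carrier_mat n n" and g: "generates_edm d P D"
    and x: "x \<in> carrier_vec n" and i: "i < n"
  shows "(D *\<^sub>v x) $ i = (row P i \<bullet> row P i) * (ones_vec n \<bullet> x)
    + (\<Sum>j<n. (row P j \<bullet> row P j) * x $ j) - 2 * ((P\<^sup>T *\<^sub>v x) \<bullet> row P i)"
proof -
  have P: "P \<in> carrier_mat n d"
    and Dij: "\<And>i j. i < n \<Longrightarrow> j < n \<Longrightarrow> D $$ (i, j) = sq_dist (row P i) (row P j)"
    using g D by (auto simp: generates_edm_def)
  have row: "row P j \<in> carrier_vec d" for j using P by auto
  have "(D *\<^sub>v x) $ i = (\<Sum>j<n. sq_dist (row P i) (row P j) * x $ j)"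
    using D x i Dij by (auto simp: scalar_prod_def atLeast0LessThan intro!: sum.cong)
  also have "\<dots> = (\<Sum>j<n. (row P i \<bullet> row P i) * x $ j + (row P j \<bullet> row P j) * x $ j
      - 2 * ((row P j \<bullet> row P i) * x $ j))"
  proof (rule sum.cong[OF refl])
    fix j
    show "sq_dist (row P i) (row P j) * x $ j = (row P i \<bullet> row P i) * x $ j
        + (row P j \<bullet> row P j) * x $ j - 2 * ((row P j \<bullet> row P i) * x $ j)"
      unfolding sq_dist_expand[OF row row] comm_scalar_prod[OF row row, of j i]
      by (simp add: algebra_simps)
  qed
  also have "\<dots> = (row P i \<bullet> row P i) * (ones_vec n \<bullet> x)
      + (\<Sum>j<n. (row P j \<bullet> row P j) * x $ j) - 2 * (\<Sum>j<n. (row P j \<bullet> row P i) * x $ j)"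
    by (simp add: sum.distrib sum_subtractf sum_distrib_left ones_vec_scalar_prod[OF x])
  finally show ?thesis by (simp add: sum_rows_scalar_prod[OF P x row])
qed

section \<open>Spherical distance matrices and their radius\<close>

lemma spherical_edm_symmetric:
  assumes "spherical_edm D \<rho>"
  shows "D\<^sup>T = D"
proof -
  obtain d P where g: "generates_edm d P D" using assms by (auto simp: spherical_edm_def)
  define m where "m = dim_row D"
  have P: "P \<in> carrier_mat m d" and D: "D \<in> carrier_mat m m"
    and Dij: "\<And>i j. i < m \<Longrightarrow> j < m \<Longrightarrow> D $$ (i, j) = sq_dist (row P i) (row P j)"
    using g unfolding generates_edm_def m_def by blast+
  have row: "row P i \<in> carrier_vec d" for i using P by auto
  have "D $$ (j, i) = D $$ (i, j)" if "i < m" "j < m" for i j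
    unfolding Dij[OF that] Dij[OF that(2,1)] sq_dist_expand[OF row row]
    using comm_scalar_prod[OF row row, of i j] by simp
  then show ?thesis using D by (intro eq_matI) simp_all
qed

lemma spherical_edm_center:
  assumes D: "D \<in> carrier_mat n n" and n: "0 < n" and s: "spherical_edm D \<rho>"
  obtains x where "x \<in> carrier_vec n" "ones_vec n \<bullet> x = 1" "D *\<^sub>v x = (2 * \<rho>\<^sup>2) \<cdot>\<^sub>v ones_vec n"
proof -
  obtain d P a where g: "generates_edm d P D" and dim: "affine_span_dim P = d"
    and a: "a \<in> carrier_vec d" and sph: "\<And>i. i < n \<Longrightarrow> sq_dist (row P i) a = \<rho>\<^sup>2"
    using s D by (auto simp: spherical_edm_def)
  have P: "P \<in> carrier_mat n d" using g D by (auto simp: generates_edm_def)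
  have row: "row P i \<in> carrier_vec d" for i using P by auto
  obtain x where x: "x \<in> carrier_vec n" "ones_vec n \<bullet> x = 1" "P\<^sup>T *\<^sub>v x = a"
    using affine_span_full[OF P n dim a] by blast
  \<comment> \<open>On the sphere the squared norm of a point is an affine function of the point, so
    its weighted sum is determined by the weighted sum \<open>a\<close> of the points.\<close>
  have norm: "row P i \<bullet> row P i = \<rho>\<^sup>2 - a \<bullet> a + 2 * (row P i \<bullet> a)" if "i < n" for i
    using sph[OF that] sq_dist_expand[OF row a] by simp
  have "(\<Sum>j<n. (row P j \<bullet> row P j) * x $ j)
      = (\<Sum>j<n. (\<rho>\<^sup>2 - a \<bullet> a) * x $ j + 2 * ((row P j \<bullet> a) * x $ j))"
    by (rule sum.cong) (auto simp: norm algebra_simps)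
  also have "\<dots> = (\<rho>\<^sup>2 - a \<bullet> a) * (ones_vec n \<bullet> x) + 2 * (\<Sum>j<n. (row P j \<bullet> a) * x $ j)"
    by (simp add: sum.distrib sum_distrib_left ones_vec_scalar_prod[OF x(1)])
  also have "\<dots> = \<rho>\<^sup>2 + a \<bullet> a" by (simp add: sum_rows_scalar_prod[OF P x(1) a] x)
  finally have S: "(\<Sum>j<n. (row P j \<bullet> row P j) * x $ j) = \<rho>\<^sup>2 + a \<bullet> a" .
  have "(D *\<^sub>v x) $ i = 2 * \<rho>\<^sup>2" if i: "i < n" for i
    by (simp add: edm_mult_vec[OF D g x(1) i] S x norm[OF i] comm_scalar_prod[OF a row])
  then have "D *\<^sub>v x = (2 * \<rho>\<^sup>2) \<cdot>\<^sub>v ones_vec n"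
    using D by (intro eq_vecI) (auto simp: ones_vec_def)
  then show thesis using that x by blast
qed

text \<open>With \<open>x\<close> the weights of the centre, evaluate the bilinear form of
  \<open>D\<close> at \<open>x\<close> and \<open>y\<close> in two ways. It is used in two
  directions: a known \<kappa> determines the radius, and an unknown \<kappa> is zero once the
  entries of \<open>y\<close> sum to 0.\<close>

lemma spherical_edm_radius_sum:
  assumes D: "D \<in> carrier_mat n n" and n: "0 < n" and s: "spherical_edm D \<rho>"
    and y: "y \<in> carrier_vec n" "D *\<^sub>v y = \<kappa> \<cdot>\<^sub>v ones_vec n"
  shows "2 * \<rho>\<^sup>2 * (ones_vec n \<bullet> y) = \<kappa>"
proof -
  obtain x where x: "x \<in> carrier_vec n" "ones_vec n \<bullet> x = 1"
    "D *\<^sub>v x = (2 * \<rho>\<^sup>2) \<cdot>\<^sub>v ones_vec n"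
    using spherical_edm_center[OF D n s] .
  have "(D *\<^sub>v x) \<bullet> y = x \<bullet> (D *\<^sub>v y)"
    using transpose_vec_mult_scalar[OF D y(1) x(1)] spherical_edm_symmetric[OF s] by simp
  then show ?thesis
    using x y by (simp add: comm_scalar_prod[OF x(1), of "ones_vec n"])
qed

section \<open>Columns of a Gale matrix lie in the kernel of \<open>D\<close>\<close>

lemma gale_matrix_col:
  assumes D: "D \<in> carrier_mat n n" and g: "gale_matrix D r Z" and j: "j < n - r - 1"
  obtains P where "generates_edm r P D" "P\<^sup>T *\<^sub>v col Z j = 0\<^sub>v r" "ones_vec n \<bullet> col Z j = 0"
proof -
  obtain P where Z: "Z \<in> carrier_mat n (n - r - 1)" and gen: "generates_edm r P D"
    and basis: "vectorspace.basis class_ring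
          (module_vec TYPE(real) n
             \<lparr>carrier := {x \<in> carrier_vec n. P\<^sup>T *\<^sub>v x = 0\<^sub>v r \<and> ones_vec n \<bullet> x = 0}\<rparr>)
          (set (cols Z))"
    using g D by (auto simp: gale_matrix_def)
  have P: "P \<in> carrier_mat n r" using gen D by (auto simp: generates_edm_def)
  then have PT: "P\<^sup>T \<in> carrier_mat r n" by simp
  define W where "W = {x \<in> carrier_vec n. P\<^sup>T *\<^sub>v x = 0\<^sub>v r \<and> ones_vec n \<bullet> x = 0}"
  interpret vec_space "TYPE(real)" n .
  \<comment> \<open>The definition of \<open>vectorspace.basis\<close> can be unfolded only for an
    actual vector space, so the Gale space is first shown to be a subspace.\<close>
  have "VectorSpace.subspace class_ring W V"
  proof (rule subspace_vec)
    show "W \<subseteq> carrier_vec n" "0\<^sub>v n \<in> W" using PT by (auto simp: W_def)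
    show "u + v \<in> W" if "u \<in> W" "v \<in> W" for u v
      using that mult_add_distrib_mat_vec[OF PT, of u v]
        scalar_prod_add_distrib[of "ones_vec n" n u v] by (simp add: W_def)
    show "b \<cdot>\<^sub>v u \<in> W" if "u \<in> W" for b u
      using that mult_mat_vec[OF PT, of u b] scalar_prod_smult_distrib[of "ones_vec n" n u b]
      by (simp add: W_def smult_zero_vec_right)
  qed
  then have "vectorspace class_ring (vs W)" by (rule subspace_is_vs)
  then have "set (cols Z) \<subseteq> W"
    using basis unfolding W_def[symmetric] by (simp add: vectorspace.basis_def)
  then have "col Z j \<in> W" using Z j by (auto simp: cols_def)
  then show thesis using that gen by (simp add: W_def)
qed

text \<open>The terms of \<open>edm_mult_vec\<close> that depend on \<open>i\<close> vanish, so
  \<open>D\<close> maps the column to a constant vector; sphericity then forces the constant to be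
  0. The points behind \<open>Z\<close> may differ from those on the sphere, and no link between the
  two is used.\<close>

lemma gale_matrix_col_mult:
  assumes D: "D \<in> carrier_mat n n" and n: "0 < n" and s: "spherical_edm D \<rho>"
    and g: "gale_matrix D r Z" and j: "j < n - r - 1"
  shows "D *\<^sub>v col Z j = 0\<^sub>v n" "ones_vec n \<bullet> col Z j = 0"
proof -
  obtain P where P: "generates_edm r P D" "P\<^sup>T *\<^sub>v col Z j = 0\<^sub>v r"
    and sum: "ones_vec n \<bullet> col Z j = 0"
    using gale_matrix_col[OF D g j] .
  have z: "col Z j \<in> carrier_vec n" using g D by (auto simp: gale_matrix_def Let_def)
  have Pn: "P \<in> carrier_mat n r" using P D by (auto simp: generates_edm_def)
  have row: "row P i \<in> carrier_vec r" for i using Pn by auto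
  define \<kappa> where "\<kappa> = (\<Sum>j'<n. (row P j' \<bullet> row P j') * col Z j $ j')"
  have "(D *\<^sub>v col Z j) $ i = \<kappa>" if "i < n" for i
    unfolding edm_mult_vec[OF D P(1) z that] \<kappa>_def P(2) sum using row by simp
  then have e: "D *\<^sub>v col Z j = \<kappa> \<cdot>\<^sub>v ones_vec n"
    using D by (intro eq_vecI) (auto simp: ones_vec_def)
  then have "\<kappa> = 0" using spherical_edm_radius_sum[OF D n s z e] sum by simp
  then show "D *\<^sub>v col Z j = 0\<^sub>v n" "ones_vec n \<bullet> col Z j = 0"
    using e sum by (auto simp: ones_vec_def)
qed

section \<open>The perturbed matrix and the theorem\<close>

lemma perturbed_mult_vec:
  assumes D: "D \<in> carrier_mat n n" and y: "y \<in> carrier_vec n"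
    and 0: "y $ k = 0" "y $ l = 0"
  shows "perturbed D k l t *\<^sub>v y = D *\<^sub>v y"
proof -
  have E: "t \<cdot>\<^sub>m sym_unit_mat n k l \<in> carrier_mat n n" by (simp add: sym_unit_mat_def)
  have "(t \<cdot>\<^sub>m sym_unit_mat n k l) *\<^sub>v y = 0\<^sub>v n"
    using y 0 by (intro eq_vecI) (auto simp: sym_unit_mat_def scalar_prod_def intro!: sum.neutral)
  then show ?thesis
    using D y add_mult_distrib_mat_vec[OF D E y] by (auto simp: perturbed_def)
qed

theorem theorem4p1:
  fixes D Ddag Z :: "real mat" and w :: "real vec" and n r k l :: nat and c :: real
  assumes "D \<in> carrier_mat n n"
    and "spherical_edm D 1"
    and "embedding_dim D r"
    and "moore_penrose D Ddag"
    and "w = Ddag *\<^sub>v ones_vec n"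
    and "k < l" and "l < n"
    and "r + 2 \<le> n \<Longrightarrow> gale_matrix D r Z"
    and "c \<noteq> 0"
    and "row (extended_gale r w Z) k = c \<cdot>\<^sub>v row (extended_gale r w Z) l"
    and "(w $ k = 0 \<and> w $ l = 0) \<or>
         (w $ k \<noteq> 0 \<and> r + 2 \<le> n \<and> row Z k \<noteq> 0\<^sub>v (n - r - 1))"
  shows "(\<forall>t \<in> T_le D k l. edm_radius (perturbed D k l t) = 1) \<and> T_eq D k l = T_le D k l"
proof -
  note D = assms(1) and s = assms(2) and kl = \<open>k < l\<close> \<open>l < n\<close>
  have n: "0 < n" using kl by simp
  have Ddag: "Ddag \<in> carrier_mat n n" and penrose: "D * Ddag * D = D"
    using assms(4) D by (auto simp: moore_penrose_def)
  have w: "w \<in> carrier_vec n" using assms(5) Ddag by simp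
  \<comment> \<open>The centre of the unit sphere shows that twice the all-ones vector is in the
    range of \<open>D\<close>, and \<open>D * Ddag\<close> fixes that range by the first Penrose
    condition.\<close>
  have Dw: "D *\<^sub>v w = ones_vec n"
  proof -
    obtain x where x: "x \<in> carrier_vec n" "D *\<^sub>v x = 2 \<cdot>\<^sub>v ones_vec n"
      using spherical_edm_center[OF D n s] by auto
    have "2 \<cdot>\<^sub>v (D *\<^sub>v w) = D *\<^sub>v (Ddag *\<^sub>v (D *\<^sub>v x))"
      using D Ddag x w by (simp add: assms(5) mult_mat_vec[of _ n n])
    also have "\<dots> = (D * Ddag * D) *\<^sub>v x"
      using D Ddag x(1) by (simp add: assoc_mult_mat_vec[of _ n n _ n])
    finally have e: "2 \<cdot>\<^sub>v (D *\<^sub>v w) = 2 \<cdot>\<^sub>v ones_vec n" using penrose x by simp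
    show ?thesis
    proof (rule eq_vecI)
      fix i assume "i < dim_vec (ones_vec n)"
      then show "(D *\<^sub>v w) $ i = ones_vec n $ i"
        using arg_cong[OF e, of "\<lambda>v. v $ i"] D by simp
    qed (use D in simp)
  qed
  have sum_w: "ones_vec n \<bullet> w = 1 / 2"
    using spherical_edm_radius_sum[OF D n s w, of 1] Dw by simp
  obtain y where y: "y \<in> carrier_vec n" "D *\<^sub>v y = ones_vec n" "ones_vec n \<bullet> y = 1 / 2"
    "y $ k = 0" "y $ l = 0"
    using assms(11)
  proof
    assume "w $ k = 0 \<and> w $ l = 0"
    then show thesis using that w Dw sum_w by blast
  next
    assume ii: "w $ k \<noteq> 0 \<and> r + 2 \<le> n \<and> row Z k \<noteq> 0\<^sub>v (n - r - 1)"
    then have g: "gale_matrix D r Z" using assms(8) by simp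
    then have Z: "Z \<in> carrier_mat n (n - r - 1)" using D by (auto simp: gale_matrix_def Let_def)
    obtain j where j: "j < n - r - 1" and Zk: "Z $$ (k, j) \<noteq> 0"
    proof (rule ccontr)
      assume "\<not> thesis"
      then have "\<And>j. j < n - r - 1 \<Longrightarrow> Z $$ (k, j) = 0" using that by blast
      then have "row Z k = 0\<^sub>v (n - r - 1)" using Z kl by (intro eq_vecI) auto
      then show False using ii by simp
    qed
    \<comment> \<open>Here \<open>r + 2 \<le> n\<close> excludes \<open>r = n - 1\<close>. Index 0
      of an extended row is the entry of \<open>w\<close>, and \<open>Suc j\<close> is that of
      column \<open>j\<close> of \<open>Z\<close>.\<close>
    have G: "extended_gale r w Z = mat_of_cols n (w # cols Z)"
      using w ii by (auto simp: extended_gale_def)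
    have row: "mat_of_cols n (w # cols Z) $$ (k, q) = c * mat_of_cols n (w # cols Z) $$ (l, q)"
      if "q < Suc (n - r - 1)" for q
      using arg_cong[OF assms(10)[unfolded G], of "\<lambda>v. v $ q"] that Z kl by simp
    have wk: "w $ k = c * w $ l"
      using row[of 0] kl by (simp add: mat_of_cols_index)
    have zk: "Z $$ (k, j) = c * Z $$ (l, j)"
      using row[of "Suc j"] kl j Z by (simp add: mat_of_cols_index)
    define z where "z = col Z j"
    have z: "z \<in> carrier_vec n" "D *\<^sub>v z = 0\<^sub>v n" "ones_vec n \<bullet> z = 0"
      using gale_matrix_col_mult[OF D n s g j] Z by (auto simp: z_def)
    have zi: "z $ k = Z $$ (k, j)" "z $ l = Z $$ (l, j)" using Z kl j by (auto simp: z_def)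
    define \<alpha> where "\<alpha> = w $ k / z $ k"
    have yk: "(w - \<alpha> \<cdot>\<^sub>v z) $ k = 0" using z(1) w kl Zk by (simp add: \<alpha>_def zi)
    \<comment> \<open>Both \<open>w $ k\<close> and \<open>z $ k\<close> are \<open>c\<close> times
      their counterparts at \<open>l\<close>, so the factor \<open>c\<close> cancels in \<alpha>;
      \<open>z $ l\<close> is nonzero because \<open>z $ k\<close> is.\<close>
    have yl: "(w - \<alpha> \<cdot>\<^sub>v z) $ l = 0"
      using z(1) w kl Zk by (simp add: \<alpha>_def zi zk wk field_simps)
    have "D *\<^sub>v (w - \<alpha> \<cdot>\<^sub>v z) = ones_vec n"
      using D w z Dw by (simp add: mult_minus_distrib_mat_vec[of _ n n] mult_mat_vec[of _ n n] smult_zero_vec_right)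
    moreover have "ones_vec n \<bullet> (w - \<alpha> \<cdot>\<^sub>v z) = 1 / 2"
      using w z sum_w by (simp add: scalar_prod_minus_distrib[of _ n])
    moreover have "w - \<alpha> \<cdot>\<^sub>v z \<in> carrier_vec n" using w z by simp
    ultimately show thesis using that yk yl by blast
  qed
  have one: "\<rho> = 1" if sp: "spherical_edm (perturbed D k l t) \<rho>" for t \<rho>
  proof -
    have "perturbed D k l t \<in> carrier_mat n n"
      using D by (simp add: perturbed_def sym_unit_mat_def)
    from spherical_edm_radius_sum[OF this n sp y(1), of 1] have "\<rho>\<^sup>2 = 1"
      using y perturbed_mult_vec[OF D y(1) y(4,5)] by simp
    moreover have "\<rho> \<ge> 0" using sp by (simp add: spherical_edm_def)
    ultimately show ?thesis by (simp add: power2_eq_1_iff)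
  qed
  have sph: "spherical_edm (perturbed D k l t) 1" if "t \<in> T_le D k l" for t
    using that one by (auto simp: T_le_def)
  \<comment> \<open>The definite description in \<open>edm_radius\<close> is settled by existence
    (\<open>sph\<close>) and uniqueness (\<open>one\<close>).\<close>
  then have "edm_radius (perturbed D k l t) = 1" if "t \<in> T_le D k l" for t
    unfolding edm_radius_def using that one by (intro the_equality)
  moreover have "T_eq D k l = T_le D k l" using sph by (auto simp: T_eq_def)
  ultimately show ?thesis by blast
qed

end
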